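(* Let $d\ge1$ be an integer, $p\ge1$, $\varepsilon\in(0,1/48)$, and $m\ge 12^d+1$ an integer. Let $E$ be a universal committee of minimum size that guarantees a regret of at most $\varepsilon$ for any set of $m$ candidates in $([0,1]^d,\|\cdot\|_p)$. Then $$\Omega\left(m\left(\frac{1}{1152\,e^{1/12}\,\varepsilon\sqrt{\pi}}\right)^d d^{d/p}\sqrt{\frac dp+1}\right)\ \le\ |E|\ \le\ O\left(m\left(\frac{3e}{\varepsilon\sqrt{2\pi}}\right)^d d^{d/p}\sqrt{\frac dp+1}\right).$$
   Context: Model (with $\Theta=[0,1]^d$ and metric $d(x,y)=\|x-y\|_p$). There are $m$ candidates $[m]=\{1,\dots,m\}$; candidate $j$ has a location $c_j\in\Theta$ (locations may coincide) and a quality $q_j\in\mathbb{R}$. A committee is a finite list $E=\{e_1,\dots,e_n\}$ of expert locations in $\Theta$, with size $|E|=n$; "universal" means that it is fixed before, and independently of, the candidates. Each expert $i$ votes for a single candidate in $\arg\max_{j\in[m]}q_j-\|e_i-c_j\|_p$ (ties broken arbitrarily). A deterministic voting rule $f$ maps candidate locations, expert locations and votes to a candidate in $[m]$. The committee guarantees regret at most $\varepsilon$ for any set of $m$ candidates if there is a deterministic voting rule such that for all candidate locations in $\Theta$, all $q\in\mathbb{R}^m$ and all votes that arise from $q$, the selected candidate $j^*$ satisfies $\max_{j\in[m]}q_j-q_{j^*}\le\varepsilon$. $O(\cdot)$ and $\Omega(\cdot)$ hide absolute constants. *)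

theory Defs
  imports Complex_Main "HOL-Library.FuncSet"
begin

text \<open>
  The dimension \<open>d\<close> is quantified inside the statement (the hidden constants must not depend
  on it), so points of \<open>[0,1]\<^sup>d\<close> are functions on \<open>{..<d}\<close>, extensional so that each point has
  exactly one representation.
\<close>

definition cube :: "nat \<Rightarrow> (nat \<Rightarrow> real) set" where
  "cube d = ({..<d} \<rightarrow>\<^sub>E {0..1})"

definition lp_dist :: "nat \<Rightarrow> real \<Rightarrow> (nat \<Rightarrow> real) \<Rightarrow> (nat \<Rightarrow> real) \<Rightarrow> real" where
  "lp_dist d p x y = (\<Sum>i<d. \<bar>x i - y i\<bar> powr p) powr (1 / p)"

definition candidate_locations :: "nat \<Rightarrow> nat \<Rightarrow> (nat \<Rightarrow> nat \<Rightarrow> real) set" where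
  "candidate_locations d m = ({1..m} \<rightarrow>\<^sub>E cube d)"

text \<open>Committees are lists: several experts may share a location, and all of them count.\<close>

definition committees :: "nat \<Rightarrow> (nat \<Rightarrow> real) list set" where
  "committees d = lists (cube d)"

definition vote_profiles :: "nat \<Rightarrow> nat \<Rightarrow> nat list set" where
  "vote_profiles m n = {v \<in> lists {1..m}. length v = n}"

text \<open>Ties are broken arbitrarily, so one quality vector can give rise to several vote profiles.\<close>

definition votes_arise ::
  "nat \<Rightarrow> real \<Rightarrow> nat \<Rightarrow> (nat \<Rightarrow> nat \<Rightarrow> real) \<Rightarrow> (nat \<Rightarrow> real) \<Rightarrow> (nat \<Rightarrow> real) list \<Rightarrow> nat list \<Rightarrow> bool"
where
  "votes_arise d p m c q E v \<longleftrightarrow>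
     length v = length E \<and>
     (\<forall>i<length E.
        is_arg_max (\<lambda>j. q j - lp_dist d p (E ! i) (c j)) (\<lambda>j. j \<in> {1..m}) (v ! i))"

definition voting_rule ::
  "nat \<Rightarrow> nat \<Rightarrow> ((nat \<Rightarrow> nat \<Rightarrow> real) \<Rightarrow> (nat \<Rightarrow> real) list \<Rightarrow> nat list \<Rightarrow> nat) \<Rightarrow> bool"
where
  "voting_rule d m f \<longleftrightarrow>
     (\<forall>c \<in> candidate_locations d m. \<forall>E \<in> committees d. \<forall>v \<in> vote_profiles m (length E).
        f c E v \<in> {1..m})"

definition guarantees_regret ::
  "nat \<Rightarrow> real \<Rightarrow> nat \<Rightarrow> real \<Rightarrow> (nat \<Rightarrow> real) list \<Rightarrow> bool"
where
  "guarantees_regret d p m \<epsilon> E \<longleftrightarrow>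
     (\<exists>f. voting_rule d m f \<and>
        (\<forall>c \<in> candidate_locations d m. \<forall>q v. votes_arise d p m c q E v \<longrightarrow>
           Max (q ` {1..m}) - q (f c E v) \<le> \<epsilon>))"

definition minimum_committee ::
  "nat \<Rightarrow> real \<Rightarrow> nat \<Rightarrow> real \<Rightarrow> (nat \<Rightarrow> real) list \<Rightarrow> bool"
where
  "minimum_committee d p m \<epsilon> E \<longleftrightarrow>
     is_arg_min length (\<lambda>E. E \<in> committees d \<and> guarantees_regret d p m \<epsilon> E) E"

end

theory Submission
  imports Defs "HOL-Analysis.Analysis"
begin

text \<open>
  Upper bound: let \<open>\<phi> x\<close> be the maximum of \<open>q j - \<parallel>x - c j\<parallel>\<close> over \<open>j\<close>, a 1-Lipschitz function. If
  \<open>q\<close> and \<open>q'\<close> produce the same votes, then at an expert voting for \<open>v\<close> the difference of their \<open>\<phi>\<close> is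
  \<open>q v - q' v\<close>; it takes at most \<open>m\<close> values on the experts. If the experts are connected by steps
  of length \<open>s\<close>, it therefore varies by at most \<open>2 s m\<close>, so the vote of an expert that maximises \<open>\<phi>\<close>
  for one consistent \<open>q\<close> is almost optimal for all of them. A grid of cell centres, joined into a
  tree whose edges are subdivided into \<open>m\<close> steps, is such a committee.

  Lower bound: a ball of radius \<open>6\<epsilon>\<close> with fewer than \<open>m - 5\<^sup>d\<close> experts can be shielded by
  candidates so that two contradictory quality vectors give the same votes. Integrating the number
  of experts in the ball over its centre bounds \<open>|E|\<close> by the volume of the \<open>\<ell>\<^sub>p\<close> ball.
\<close>

subsection \<open>The \<open>\<ell>\<^sub>p\<close> distance\<close>

text \<open>If \<open>u\<close> or \<open>v\<close> vanishes, this reduces to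
  \<open>t powr p \<le> t\<close> on the unit interval; otherwise it is convexity on the positive
  reals.\<close>

lemma powr_convex_nonneg:
  fixes u v l p :: real
  assumes "p \<ge> 1" "u \<ge> 0" "v \<ge> 0" "0 \<le> l" "l \<le> 1"
  shows "(l * u + (1 - l) * v) powr p \<le> l * u powr p + (1 - l) * v powr p"
proof -
  have small: "t powr p \<le> t" if "0 \<le> t" "t \<le> 1" for t :: real
    using powr_mono'[of 1 p t] that assms(1) by (cases "t = 0") auto
  consider "u = 0" | "v = 0" | "u > 0" "v > 0"
    using assms by linarith
  then show ?thesis
  proof cases
    case 1
    have "(1 - l) powr p * v powr p \<le> (1 - l) * v powr p"
      using small[of "1 - l"] assms by (intro mult_right_mono) auto
    then show ?thesis using 1 assms by (simp add: powr_mult)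
  next
    case 2
    have "l powr p * u powr p \<le> l * u powr p"
      using small[of l] assms by (intro mult_right_mono) auto
    then show ?thesis using 2 assms by (simp add: powr_mult)
  next
    case 3
    show ?thesis
      using convex_onD[OF powr_convex[OF assms(1)], of l v u] 3 assms by (simp add: add.commute)
  qed
qed

text \<open>After dividing by \<open>A + B\<close>, the vector of
  \<open>\<bar>x i\<bar> + \<bar>y i\<bar>\<close> is a convex combination of the normalised vectors
  \<open>\<bar>x i\<bar> / A\<close> and \<open>\<bar>y i\<bar> / B\<close>. The p-th powers of each
  of those sum to one, so convexity in every coordinate followed by summation suffices.\<close>

lemma Minkowski_sum:
  fixes x y :: "'a \<Rightarrow> real"
  assumes p: "p \<ge> 1" and fin: "finite I"
  shows "(\<Sum>i\<in>I. \<bar>x i + y i\<bar> powr p) powr (1 / p)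
           \<le> (\<Sum>i\<in>I. \<bar>x i\<bar> powr p) powr (1 / p) + (\<Sum>i\<in>I. \<bar>y i\<bar> powr p) powr (1 / p)"
proof -
  define A where "A = (\<Sum>i\<in>I. \<bar>x i\<bar> powr p) powr (1 / p)"
  define B where "B = (\<Sum>i\<in>I. \<bar>y i\<bar> powr p) powr (1 / p)"
  have Ap: "A powr p = (\<Sum>i\<in>I. \<bar>x i\<bar> powr p)" and Bp: "B powr p = (\<Sum>i\<in>I. \<bar>y i\<bar> powr p)"
    using p by (auto simp: A_def B_def powr_powr sum_nonneg)
  have nn: "A \<ge> 0" "B \<ge> 0" by (auto simp: A_def B_def)
  show ?thesis
  \<comment> \<open>A vector of norm zero cannot be normalised, but it vanishes in every
    coordinate.\<close>
  proof (cases "A = 0 \<or> B = 0")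
    case True
    then show ?thesis
    proof
      assume "A = 0"
      then have "(\<Sum>i\<in>I. \<bar>x i\<bar> powr p) = 0" using Ap by simp
      then have "\<forall>i\<in>I. x i = 0" by (subst (asm) sum_nonneg_eq_0_iff) (auto simp: fin)
      then show ?thesis by simp
    next
      assume "B = 0"
      then have "(\<Sum>i\<in>I. \<bar>y i\<bar> powr p) = 0" using Bp by simp
      then have "\<forall>i\<in>I. y i = 0" by (subst (asm) sum_nonneg_eq_0_iff) (auto simp: fin)
      then show ?thesis by simp
    qed
  next
    case False
    then have pos: "A > 0" "B > 0" using nn by auto
    define l where "l = A / (A + B)"
    have l: "0 \<le> l" "l \<le> 1" and l1: "1 - l = B / (A + B)"
      using pos by (auto simp: l_def field_simps)
    have term_le: "\<bar>x i + y i\<bar> powr p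
        \<le> (A + B) powr p * (l * (\<bar>x i\<bar> powr p / A powr p) + (1 - l) * (\<bar>y i\<bar> powr p / B powr p))" for i
    proof -
      have eq: "l * (\<bar>x i\<bar> / A) + (1 - l) * (\<bar>y i\<bar> / B) = (\<bar>x i\<bar> + \<bar>y i\<bar>) / (A + B)"
        unfolding l1 unfolding l_def using pos by (simp add: add_divide_distrib)
      have "\<bar>x i + y i\<bar> powr p \<le> (\<bar>x i\<bar> + \<bar>y i\<bar>) powr p"
        using p by (intro powr_mono2) auto
      also have "\<dots> = (A + B) powr p * ((\<bar>x i\<bar> + \<bar>y i\<bar>) / (A + B)) powr p"
        using pos by (simp flip: powr_mult)
      also have "\<dots> \<le> (A + B) powr p * (l * (\<bar>x i\<bar> / A) powr p + (1 - l) * (\<bar>y i\<bar> / B) powr p)"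
        unfolding eq[symmetric]
        using pos l by (intro mult_left_mono powr_convex_nonneg p) auto
      also have "\<dots> = (A + B) powr p * (l * (\<bar>x i\<bar> powr p / A powr p) + (1 - l) * (\<bar>y i\<bar> powr p / B powr p))"
        using pos by (simp add: powr_divide)
      finally show ?thesis .
    qed
    have "(\<Sum>i\<in>I. \<bar>x i + y i\<bar> powr p)
        \<le> (\<Sum>i\<in>I. (A + B) powr p * (l * (\<bar>x i\<bar> powr p / A powr p) + (1 - l) * (\<bar>y i\<bar> powr p / B powr p)))"
      by (intro sum_mono term_le)
    also have "\<dots> = (A + B) powr p * (l * ((\<Sum>i\<in>I. \<bar>x i\<bar> powr p) / A powr p)
                     + (1 - l) * ((\<Sum>i\<in>I. \<bar>y i\<bar> powr p) / B powr p))"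
      by (simp only: sum_distrib_left[symmetric] sum.distrib sum_divide_distrib[symmetric])
    also have "\<dots> = (A + B) powr p"
      using pos by (simp flip: Ap Bp)
    finally have "(\<Sum>i\<in>I. \<bar>x i + y i\<bar> powr p) powr (1 / p) \<le> ((A + B) powr p) powr (1 / p)"
      using p by (intro powr_mono2) (auto intro!: sum_nonneg)
    also have "\<dots> = A + B" using p pos by (simp add: powr_powr)
    finally show ?thesis by (simp add: A_def B_def)
  qed
qed

lemma lp_dist_nonneg: "lp_dist d p x y \<ge> 0"
  by (simp add: lp_dist_def)

lemma lp_dist_self [simp]: "lp_dist d p x x = 0"
  by (simp add: lp_dist_def)

lemma lp_dist_commute: "lp_dist d p x y = lp_dist d p y x"
  by (simp add: lp_dist_def abs_minus_commute)

lemma lp_dist_triangle: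
  assumes "p \<ge> 1"
  shows "lp_dist d p x z \<le> lp_dist d p x y + lp_dist d p y z"
  using Minkowski_sum[OF assms finite_lessThan, of "\<lambda>i. x i - y i" "\<lambda>i. y i - z i" d]
  by (simp add: lp_dist_def)

lemma lp_dist_scale:
  assumes "p \<ge> 1" "\<And>i. i < d \<Longrightarrow> \<bar>x i - y i\<bar> = t * \<bar>u i - v i\<bar>" "t \<ge> 0"
  shows "lp_dist d p x y = t * lp_dist d p u v"
proof -
  have "(\<Sum>i<d. \<bar>x i - y i\<bar> powr p) = t powr p * (\<Sum>i<d. \<bar>u i - v i\<bar> powr p)"
    using assms(2,3) by (simp add: sum_distrib_left powr_mult)
  then show ?thesis
    using assms(1,3) by (simp add: lp_dist_def powr_mult powr_powr sum_nonneg)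
qed

lemma lp_dist_le_coordinatewise:
  assumes "p \<ge> 1" "\<And>i. i < d \<Longrightarrow> \<bar>x i - y i\<bar> \<le> h" "h \<ge> 0"
  shows "lp_dist d p x y \<le> h * real d powr (1 / p)"
proof -
  have "(\<Sum>i<d. \<bar>x i - y i\<bar> powr p) \<le> (\<Sum>i<d. h powr p)"
    using assms by (intro sum_mono powr_mono2) auto
  then have "lp_dist d p x y \<le> (real d * h powr p) powr (1 / p)"
    using assms(1) unfolding lp_dist_def by (intro powr_mono2) (auto intro!: sum_nonneg)
  also have "\<dots> = h * real d powr (1 / p)"
    using assms(1,3) by (simp add: powr_mult powr_powr)
  finally show ?thesis .
qed

lemma lp_dist_single_coordinate:
  assumes "p \<ge> 1" "k < d" "\<And>i. i < d \<Longrightarrow> i \<noteq> k \<Longrightarrow> x i = y i"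
  shows "lp_dist d p x y = \<bar>x k - y k\<bar>"
proof -
  have "(\<Sum>i<d. \<bar>x i - y i\<bar> powr p) = (\<Sum>i<d. if i = k then \<bar>x k - y k\<bar> powr p else 0)"
    using assms(3) by (intro sum.cong) auto
  then show ?thesis
    using assms(1,2) by (simp add: lp_dist_def powr_powr)
qed

subsection \<open>Connected committees have small regret\<close>

text \<open>This is \<phi> of the overview: the utility that a voter at \<open>x\<close> gets from a
  favourite candidate.\<close>

definition score :: "nat \<Rightarrow> real \<Rightarrow> nat \<Rightarrow> (nat \<Rightarrow> nat \<Rightarrow> real) \<Rightarrow> (nat \<Rightarrow> real) \<Rightarrow> (nat \<Rightarrow> real) \<Rightarrow> real"
  where "score d p m c q x = Max ((\<lambda>j. q j - lp_dist d p x (c j)) ` {1..m})"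

lemma score_ge: "j \<in> {1..m} \<Longrightarrow> q j - lp_dist d p x (c j) \<le> score d p m c q x"
  unfolding score_def by (intro Max_ge) auto

text \<open>An upper envelope of 1-Lipschitz functions is 1-Lipschitz: the candidate that is best at
  \<open>x\<close> is compared with its value at \<open>y\<close>.\<close>

lemma score_lipschitz:
  assumes "p \<ge> 1" "m \<ge> 1"
  shows "score d p m c q x \<le> score d p m c q y + lp_dist d p x y"
proof -
  have "score d p m c q x \<in> (\<lambda>j. q j - lp_dist d p x (c j)) ` {1..m}"
    unfolding score_def using assms(2) by (intro Max_in) auto
  then obtain j where j: "j \<in> {1..m}" "score d p m c q x = q j - lp_dist d p x (c j)"
    by auto
  have "lp_dist d p y (c j) \<le> lp_dist d p x y + lp_dist d p x (c j)"
    using lp_dist_triangle[OF assms(1), of d y "c j" x] by (simp add: lp_dist_commute)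
  then show ?thesis
    using score_ge[OF j(1), of q d p y c] j(2) by linarith
qed

text \<open>The vote makes the envelope explicit at an expert. For two quality vectors with equal
  votes the distance terms then cancel.\<close>

lemma votes_arise_score:
  assumes "votes_arise d p m c q E v" "i < length E"
  shows "v ! i \<in> {1..m}"
    and "score d p m c q (E ! i) = q (v ! i) - lp_dist d p (E ! i) (c (v ! i))"
proof -
  have am: "is_arg_max (\<lambda>j. q j - lp_dist d p (E ! i) (c j)) (\<lambda>j. j \<in> {1..m}) (v ! i)"
    using assms by (auto simp: votes_arise_def)
  then show v: "v ! i \<in> {1..m}"
    by (auto simp: is_arg_max_def)
  show "score d p m c q (E ! i) = q (v ! i) - lp_dist d p (E ! i) (c (v ! i))"
    unfolding score_def
  proof (rule Max_eqI)
    fix y assume "y \<in> (\<lambda>j. q j - lp_dist d p (E ! i) (c j)) ` {1..m}"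
    then obtain j where "j \<in> {1..m}" "y = q j - lp_dist d p (E ! i) (c j)"
      by blast
    then show "y \<le> q (v ! i) - lp_dist d p (E ! i) (c (v ! i))"
      using am unfolding is_arg_max_def by force
  qed (use v in auto)
qed

section \<open>Variation of a function along chains of short steps\<close>

definition steps :: "('a \<Rightarrow> 'a \<Rightarrow> real) \<Rightarrow> real \<Rightarrow> 'a set \<Rightarrow> ('a \<times> 'a) set"
  where "steps \<rho> s A = {(x, y). x \<in> A \<and> y \<in> A \<and> \<rho> x y \<le> s}"

lemma rtrancl_crossing:
  assumes "(x, y) \<in> r\<^sup>*" "P x" "\<not> P y"
  obtains a b where "(a, b) \<in> r" "P a" "\<not> P b"
  using assms by (induction rule: rtrancl_induct) blast+

text \<open>Climb from \<open>y\<close> towards \<open>x\<close>: each move gains at most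
  \<open>w\<close> and lands on a strictly larger element of \<open>V\<close>, so there are at most
  as many moves as elements above \<open>y\<close>.\<close>

lemma spread_le_card:
  fixes V :: "real set"
  assumes "finite V" "w \<ge> 0" "y \<in> V"
    and gap: "\<And>v. v \<in> V \<Longrightarrow> v < x \<Longrightarrow> \<exists>v'\<in>V. v < v' \<and> v' \<le> v + w"
  shows "x \<le> y + w * real (card {v \<in> V. y < v})"
  using \<open>y \<in> V\<close>
proof (induction "card {v \<in> V. y < v}" arbitrary: y rule: less_induct)
  case less
  show ?case
  proof (cases "x \<le> y")
    case True
    then show ?thesis using \<open>w \<ge> 0\<close> by (simp add: add_increasing2)
  next
    case False
    then obtain v where v: "v \<in> V" "y < v" "v \<le> y + w"
      using gap less.prems by force
    have "{u \<in> V. v < u} \<subset> {u \<in> V. y < u}"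
      using v by force
    then have lt: "card {u \<in> V. v < u} < card {u \<in> V. y < u}"
      using \<open>finite V\<close> by (intro psubset_card_mono) auto
    then have "w * (real (card {u \<in> V. v < u}) + 1) \<le> w * real (card {u \<in> V. y < u})"
      using \<open>w \<ge> 0\<close> by (intro mult_left_mono) auto
    then show ?thesis
      using less.hyps[OF lt v(1)] v(3) by (simp add: algebra_simps)
  qed
qed

text \<open>
  Only the number of values of \<open>F\<close> matters, not the length of the path: a path may re-enter
  the same level set for free.
\<close>

lemma spread_along_steps:
  fixes F :: "'a \<Rightarrow> real"
  assumes "finite (F ` A)" "card (F ` A) \<le> m" "w \<ge> 0"
    and step: "\<And>a b. (a, b) \<in> steps \<rho> s A \<Longrightarrow> F b \<le> F a + w"
    and conn: "\<And>a b. a \<in> A \<Longrightarrow> b \<in> A \<Longrightarrow> (a, b) \<in> (steps \<rho> s A)\<^sup>*"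
    and "x \<in> A" "y \<in> A"
  shows "F x \<le> F y + w * real m"
proof -
  have "F x \<le> F y + w * real (card {v \<in> F ` A. F y < v})"
  \<comment> \<open>A chain from a point of value \<open>v\<close> to \<open>x\<close> must leave
    the sublevel set of \<open>v\<close>; the value just after leaving it is the next larger
    one.\<close>
  proof (rule spread_le_card)
    fix v assume "v \<in> F ` A" "v < F x"
    then obtain z where z: "z \<in> A" "v = F z" by auto
    obtain a b where "(a, b) \<in> steps \<rho> s A" "F a \<le> v" "\<not> F b \<le> v"
      using rtrancl_crossing[OF conn[OF z(1) \<open>x \<in> A\<close>], of "\<lambda>u. F u \<le> v"] z \<open>v < F x\<close> by auto
    then show "\<exists>v'\<in>F ` A. v < v' \<and> v' \<le> v + w"
      using step[of a b] by (intro bexI[of _ "F b"]) (auto simp: steps_def)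
  qed (use assms in auto)
  moreover have "card {v \<in> F ` A. F y < v} \<le> m"
    using card_mono[OF assms(1), of "{v \<in> F ` A. F y < v}"] assms(2) by auto
  then have "w * real (card {v \<in> F ` A. F y < v}) \<le> w * real m"
    using \<open>w \<ge> 0\<close> by (intro mult_left_mono) auto
  ultimately show ?thesis by linarith
qed

text \<open>The best candidate has an expert \<open>e\<close> within \<open>r\<close>. Up to
  \<open>2 * s * real m\<close>, the expert that leads for one consistent quality vector scores as
  high as \<open>e\<close> for the true one, and the quality of its favourite is at least its
  score.\<close>

lemma guarantees_regret_of_chain_connected:
  assumes p: "p \<ge> 1" and m: "m \<ge> 1" and E: "E \<in> committees d" and s: "s \<ge> 0"
    and cover: "\<And>x. x \<in> cube d \<Longrightarrow> \<exists>e\<in>set E. lp_dist d p e x \<le> r"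
    and conn: "\<And>a b. a \<in> set E \<Longrightarrow> b \<in> set E \<Longrightarrow> (a, b) \<in> (steps (lp_dist d p) s (set E))\<^sup>*"
    and eps: "r + 2 * s * real m \<le> \<epsilon>"
  shows "guarantees_regret d p m \<epsilon> E"
proof -
  \<comment> \<open>The quality vector is quantified away, so leadership depends only on what a
    voting rule may see.\<close>
  define leader where "leader c E v i \<longleftrightarrow> i < length E \<and>
      (\<exists>q. votes_arise d p m c q E v \<and> (\<forall>e\<in>set E. score d p m c q e \<le> score d p m c q (E ! i)))"
    for c E v i
  \<comment> \<open>The value \<open>1\<close> is a default for profiles without a leader; it keeps
    \<open>f\<close> a voting rule.\<close>
  define f where "f c E v = (if \<exists>i. leader c E v i then v ! (SOME i. leader c E v i) else 1)"
    for c E v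
  have "voting_rule d m f"
    unfolding voting_rule_def
  proof (intro ballI)
    fix c and E :: "(nat \<Rightarrow> real) list" and v
    assume v: "v \<in> vote_profiles m (length E)"
    show "f c E v \<in> {1..m}"
    proof (cases "\<exists>i. leader c E v i")
      case True
      then have "leader c E v (SOME i. leader c E v i)" by (rule someI_ex)
      then have "(SOME i. leader c E v i) < length v"
        using v by (auto simp: leader_def vote_profiles_def)
      then show ?thesis
        using v True nth_mem[of "SOME i. leader c E v i" v] by (auto simp: f_def vote_profiles_def)
    next
      case False
      then show ?thesis using m by (simp add: f_def)
    qed
  qed
  moreover have "Max (q ` {1..m}) - q (f c E v) \<le> \<epsilon>"
    if c: "c \<in> candidate_locations d m" and arise: "votes_arise d p m c q E v" for c q v
  proof -
    have "Max (q ` {1..m}) \<in> q ` {1..m}" using m by (intro Max_in) auto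
    then obtain j where j: "j \<in> {1..m}" "Max (q ` {1..m}) = q j" by auto
    have "c j \<in> cube d" using c j(1) by (auto simp: candidate_locations_def)
    then obtain e where e: "e \<in> set E" "lp_dist d p e (c j) \<le> r" using cover by blast
    \<comment> \<open>A leader exists: the expert with the highest score for the actual
      \<open>q\<close> is one, with \<open>q\<close> itself as witness.\<close>
    have "Max (score d p m c q ` set E) \<in> score d p m c q ` set E"
      using e(1) by (intro Max_in) auto
    then obtain e' where "e' \<in> set E" "score d p m c q e' = Max (score d p m c q ` set E)"
      by auto
    then have "e' \<in> set E" "\<forall>e\<in>set E. score d p m c q e \<le> score d p m c q e'"
      by auto
    then have "\<exists>i. leader c E v i"
      using arise unfolding leader_def in_set_conv_nth by blast
    moreover define i where "i = (SOME i. leader c E v i)"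
    ultimately have "leader c E v i" and f: "f c E v = v ! i"
      by (auto simp: f_def intro: someI)
    then obtain q0 where i: "i < length E" and q0: "votes_arise d p m c q0 E v"
      and top: "score d p m c q0 e \<le> score d p m c q0 (E ! i)"
      using e(1) unfolding leader_def by blast
    define F where "F x = score d p m c q x - score d p m c q0 x" for x
    \<comment> \<open>The value of \<open>F\<close> at an expert depends only on the vote cast
      there, which leaves at most \<open>m\<close> values.\<close>
    have F_vote: "F ` set E \<subseteq> (\<lambda>j. q j - q0 j) ` {1..m}"
    proof
      fix z assume "z \<in> F ` set E"
      then obtain l where "l < length E" "z = F (E ! l)" by (auto simp: in_set_conv_nth)
      then show "z \<in> (\<lambda>j. q j - q0 j) ` {1..m}"
        using votes_arise_score[OF arise, of l] votes_arise_score[OF q0, of l]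
        by (intro image_eqI[of _ _ "v ! l"]) (auto simp: F_def)
    qed
    have "F e \<le> F (E ! i) + 2 * s * real m"
    proof (rule spread_along_steps[where F = F and \<rho> = "lp_dist d p" and s = s and A = "set E"])
      show "finite (F ` set E)" by simp
      show "card (F ` set E) \<le> m"
        using card_mono[OF _ F_vote] card_image_le[of "{1..m}" "\<lambda>j. q j - q0 j"] by auto
      \<comment> \<open>Each of the two scores changes by at most \<open>s\<close> along a
        step.\<close>
      show "F b \<le> F a + 2 * s" if "(a, b) \<in> steps (lp_dist d p) s (set E)" for a b
        using that score_lipschitz[OF p m, of d c q b a] score_lipschitz[OF p m, of d c q0 a b]
          lp_dist_commute[of d p a b] by (auto simp: F_def steps_def)
    qed (use s conn e(1) i in auto)
    then have "score d p m c q e \<le> score d p m c q (E ! i) + 2 * s * real m"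
      using top by (simp add: F_def)
    moreover have "score d p m c q (E ! i) \<le> q (v ! i)"
      using votes_arise_score(2)[OF arise i] lp_dist_nonneg[of d p "E ! i" "c (v ! i)"] by linarith
    moreover have "q j - r \<le> score d p m c q e"
      using score_ge[OF j(1), of q d p e c] e(2) by linarith
    ultimately show ?thesis unfolding f using eps j(2) by linarith
  qed
  ultimately show ?thesis unfolding guarantees_regret_def by blast
qed

subsection \<open>A subdivided grid tree\<close>

text \<open>
  For \<open>t = 0\<close> these are the centres of the \<open>k\<^sup>d\<close> cells; as \<open>t\<close> runs to \<open>m\<close> the point moves to the
  centre of the parent cell, obtained by decrementing the first nonzero coordinate.
\<close>

definition first_nonzero :: "(nat \<Rightarrow> nat) \<Rightarrow> nat \<Rightarrow> bool"
  where "first_nonzero g i \<longleftrightarrow> g i > 0 \<and> (\<forall>j<i. g j = 0)"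

lemma first_nonzero_unique: "first_nonzero g i \<Longrightarrow> first_nonzero g j \<Longrightarrow> i = j"
  unfolding first_nonzero_def by (metis less_not_refl nat_neq_iff)

definition tree_point :: "nat \<Rightarrow> nat \<Rightarrow> nat \<Rightarrow> (nat \<Rightarrow> nat) \<Rightarrow> nat \<Rightarrow> nat \<Rightarrow> real" where
  "tree_point d k m g t = (\<lambda>i\<in>{..<d}.
     (real (g i) + 1 / 2 - (if first_nonzero g i then real t / real m else 0)) / real k)"

text \<open>The time \<open>t = m\<close> is left out because it repeats the parent centre, or the
  same point when no coordinate is nonzero.\<close>

definition tree_points :: "nat \<Rightarrow> nat \<Rightarrow> nat \<Rightarrow> (nat \<Rightarrow> real) set" where
  "tree_points d k m = (\<lambda>(g, t). tree_point d k m g t) ` (({..<d} \<rightarrow>\<^sub>E {..<k}) \<times> {..<m})"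

lemma card_tree_points: "finite (tree_points d k m)" "card (tree_points d k m) \<le> k ^ d * m"
proof -
  have fin: "finite (({..<d} \<rightarrow>\<^sub>E {..<k}) \<times> {..<m})" by (intro finite_cartesian_product finite_PiE) auto
  then show "finite (tree_points d k m)" by (simp add: tree_points_def)
  show "card (tree_points d k m) \<le> k ^ d * m"
    unfolding tree_points_def
    by (rule order_trans[OF card_image_le[OF fin]]) (simp add: card_cartesian_product card_PiE)
qed

lemma tree_points_subset_cube:
  assumes "m \<ge> 1"
  shows "tree_points d k m \<subseteq> cube d"
proof -
  have "tree_point d k m g t \<in> cube d" if g: "g \<in> {..<d} \<rightarrow>\<^sub>E {..<k}" and t: "t < m" for g t
  proof -
    have "0 \<le> tree_point d k m g t i \<and> tree_point d k m g t i \<le> 1" if "i < d" for i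
    proof -
      have "g i < k" using g that by auto
      then have "real (g i) + 1 \<le> real k" by linarith
      moreover define u where "u = (if first_nonzero g i then real t / real m else 0)"
      moreover have "real t / real m \<le> 1" using t by auto
      \<comment> \<open>Only a coordinate with \<open>g i \<ge> 1\<close> is shifted, and by at most
        one, so the point stays in the cube.\<close>
      then have "0 \<le> u" "u \<le> real (g i)"
        by (auto simp: u_def first_nonzero_def Suc_leI intro: order_trans)
      ultimately show ?thesis
        using that \<open>g i < k\<close> by (simp add: tree_point_def flip: u_def)
    qed
    then show ?thesis by (auto simp: cube_def tree_point_def)
  qed
  then show ?thesis by (auto simp: tree_points_def)
qed

text \<open>At most one coordinate moves, so the step length depends on neither \<open>p\<close> nor
  \<open>d\<close>.\<close>

lemma tree_point_step:
  assumes "p \<ge> 1"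
  shows "lp_dist d p (tree_point d k m g t) (tree_point d k m g (Suc t)) \<le> 1 / (real m * real k)"
proof (cases "\<exists>l<d. first_nonzero g l")
  case True
  then obtain l where l: "l < d" "first_nonzero g l" by blast
  have "lp_dist d p (tree_point d k m g t) (tree_point d k m g (Suc t))
      = \<bar>tree_point d k m g t l - tree_point d k m g (Suc t) l\<bar>"
  proof (rule lp_dist_single_coordinate[OF assms l(1)])
    fix i assume "i < d" "i \<noteq> l"
    then have "\<not> first_nonzero g i"
      using l(2) first_nonzero_unique by blast
    then show "tree_point d k m g t i = tree_point d k m g (Suc t) i"
      using \<open>i < d\<close> unfolding tree_point_def by (simp only: if_False restrict_apply)
  qed
  also have "tree_point d k m g t l - tree_point d k m g (Suc t) l = 1 / (real m * real k)"
    using l by (simp add: tree_point_def diff_divide_distrib[symmetric] add_divide_distrib)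
  finally show ?thesis by simp
next
  case False
  then have "tree_point d k m g t = tree_point d k m g (Suc t)"
    by (auto simp: tree_point_def intro!: restrict_ext)
  then show ?thesis by simp
qed

text \<open>At time \<open>m\<close> the shift is one full cell. At time \<open>0\<close> the parent
  has no shift, whichever of its coordinates is first nonzero.\<close>

lemma tree_point_parent:
  assumes "m \<ge> 1" "l < d" "first_nonzero g l"
  shows "tree_point d k m g m = tree_point d k m (g(l := g l - 1)) 0"
proof -
  define h where "h = g(l := g l - 1)"
  have "real (g i) + 1 / 2 - (if first_nonzero g i then real m / real m else 0)
      = real (h i) + 1 / 2 - (if first_nonzero h i then real 0 / real m else 0)" for i
  proof (cases "i = l")
    case True
    then show ?thesis using assms by (simp add: h_def of_nat_diff first_nonzero_def)
  next
    case False
    then have "\<not> first_nonzero g i"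
      using assms(3) first_nonzero_unique by blast
    then show ?thesis using False by (simp add: h_def)
  qed
  then show ?thesis unfolding tree_point_def h_def[symmetric] by presburger
qed

lemma tree_point_mem:
  assumes m: "m \<ge> 1" and g: "g \<in> {..<d} \<rightarrow>\<^sub>E {..<k}" and t: "t \<le> m"
  shows "tree_point d k m g t \<in> tree_points d k m"
proof -
  have mem: "tree_point d k m h u \<in> tree_points d k m" if "h \<in> {..<d} \<rightarrow>\<^sub>E {..<k}" "u < m" for h u
    unfolding tree_points_def using that by (intro image_eqI[of _ _ "(h, u)"]) auto
  show ?thesis
  proof (cases "t < m")
    case True
    then show ?thesis using mem g by blast
  next
    case False
    then have t: "t = m" using t by simp
    show ?thesis
    proof (cases "\<exists>l<d. first_nonzero g l")
      case True
      then obtain l where l: "l < d" "first_nonzero g l" by blast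
      then have "g l - 1 < k" using g l by (auto intro: less_imp_diff_less)
      then have "g(l := g l - 1) \<in> {..<d} \<rightarrow>\<^sub>E {..<k}"
        using g l by (auto simp: PiE_iff extensional_def)
      then show ?thesis
        unfolding t tree_point_parent[OF m l] using mem m by auto
    next
      case False
      then have "tree_point d k m g t = tree_point d k m g 0"
        by (auto simp: tree_point_def intro!: restrict_ext)
      then show ?thesis using mem g m by auto
    qed
  qed
qed

text \<open>Every point runs along its edge to the parent centre. Parents have a smaller coordinate
  sum, so induction on that sum reaches the root; symmetry of the steps joins two such
  paths.\<close>

lemma tree_points_connected:
  assumes p: "p \<ge> 1" and m: "m \<ge> 1"
    and "a \<in> tree_points d k m" "b \<in> tree_points d k m"
  shows "(a, b) \<in> (steps (lp_dist d p) (1 / (real m * real k)) (tree_points d k m))\<^sup>*"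
proof -
  define R where "R = steps (lp_dist d p) (1 / (real m * real k)) (tree_points d k m)"
  define root where "root = tree_point d k m (\<lambda>i. 0) 0"
  have "sym R"
    by (auto simp: R_def steps_def lp_dist_commute intro: symI)
  have to_root: "(tree_point d k m g t, root) \<in> R\<^sup>*"
    if "g \<in> {..<d} \<rightarrow>\<^sub>E {..<k}" "t \<le> m" for g t
    using that
  proof (induction "\<Sum>i<d. g i" arbitrary: g t rule: less_induct)
    case less
    show ?case
    proof (cases "\<exists>l<d. g l > 0")
      case True
      then obtain l where "l < d" "g l > 0" "\<forall>j<l. \<not> (j < d \<and> g j > 0)"
        using exists_least_iff[of "\<lambda>l. l < d \<and> g l > 0"] by auto
      then have l: "l < d" "g l > 0" "first_nonzero g l" by (auto simp: first_nonzero_def)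
      define h where "h = g(l := g l - 1)"
      have "g l - 1 < k" using l less.prems(1) by (auto intro: less_imp_diff_less)
      then have "h \<in> {..<d} \<rightarrow>\<^sub>E {..<k}"
        using less.prems(1) l by (auto simp: h_def PiE_iff extensional_def)
      moreover have "(\<Sum>i<d. h i) < (\<Sum>i<d. g i)"
        using l by (intro sum_strict_mono_ex1) (auto simp: h_def)
      ultimately have "(tree_point d k m h 0, root) \<in> R\<^sup>*"
        using less.hyps by blast
      then have end_path: "(tree_point d k m g m, root) \<in> R\<^sup>*"
        using tree_point_parent[OF m l(1,3)] by (simp add: h_def)
      \<comment> \<open>This induction runs downwards from \<open>m\<close>, the end of the edge, to
        \<open>t\<close>.\<close>
      from \<open>t \<le> m\<close> show ?thesis
      proof (induction t rule: inc_induct)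
        case base
        show ?case by (rule end_path)
      next
        case (step u)
        have "(tree_point d k m g u, tree_point d k m g (Suc u)) \<in> R"
          using tree_point_step[OF p] tree_point_mem[OF m less.prems(1)] step(2)
          by (auto simp: R_def steps_def)
        then show ?case using step.IH by (meson converse_rtrancl_into_rtrancl)
      qed
    next
      case False
      then have "tree_point d k m g t = root"
        by (auto simp: tree_point_def root_def first_nonzero_def intro!: restrict_ext)
      then show ?thesis by simp
    qed
  qed
  have "(x, root) \<in> R\<^sup>*" if "x \<in> tree_points d k m" for x
    using that to_root by (force simp: tree_points_def)
  then have "(a, root) \<in> R\<^sup>*" "(b, root) \<in> R\<^sup>*" using assms by auto
  then have "(a, b) \<in> R\<^sup>*"
    using symD[OF sym_rtrancl[OF \<open>sym R\<close>]] by (meson rtrancl_trans)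
  then show ?thesis by (simp add: R_def)
qed

section \<open>Covering the cube by grid cells, and the size of the resulting committee\<close>

lemma unit_interval_cell:
  fixes x :: real
  assumes "k \<ge> 1" "0 \<le> x" "x \<le> 1"
  obtains j where "j < k" "real j \<le> real k * x" "real k * x \<le> real j + 1"
proof (cases "x = 1")
  case True
  \<comment> \<open>The right endpoint belongs to the last cell; rounding down would give the
    invalid index \<open>k\<close>.\<close>
  then show ?thesis using that[of "k - 1"] assms by (auto simp: of_nat_diff)
next
  case False
  then have kx: "0 \<le> real k * x" "real k * x < real k" using assms by auto
  show ?thesis
  proof (rule that[of "nat \<lfloor>real k * x\<rfloor>"])
    show "nat \<lfloor>real k * x\<rfloor> < k" using kx by linarith
  qed (use kx in linarith)+
qed

lemma tree_points_cover:
  assumes p: "p \<ge> 1" and m: "m \<ge> 1" and k: "k \<ge> 1" and x: "x \<in> cube d"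
  shows "\<exists>e\<in>tree_points d k m. lp_dist d p e x \<le> real d powr (1 / p) / (2 * real k)"
proof -
  have "\<exists>j<k. real j \<le> real k * x i \<and> real k * x i \<le> real j + 1" if "i < d" for i
    using unit_interval_cell[OF k, of "x i"] x that unfolding cube_def
    by (metis PiE_mem atLeastAtMost_iff lessThan_iff)
  then obtain g0 where g0: "\<And>i. i < d \<Longrightarrow> g0 i < k \<and> real (g0 i) \<le> real k * x i \<and> real k * x i \<le> real (g0 i) + 1"
    by metis
  define g where "g = restrict g0 {..<d}"
  have "g \<in> {..<d} \<rightarrow>\<^sub>E {..<k}" using g0 by (auto simp: g_def)
  then have mem: "tree_point d k m g 0 \<in> tree_points d k m" using tree_point_mem[OF m] by simp
  have "lp_dist d p (tree_point d k m g 0) x \<le> 1 / (2 * real k) * real d powr (1 / p)"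
  proof (rule lp_dist_le_coordinatewise[OF p])
    fix i assume i: "i < d"
    have "tree_point d k m g 0 i - x i = (real (g0 i) + 1 / 2 - real k * x i) / real k"
      using i k by (simp add: tree_point_def g_def field_simps)
    also have "\<bar>\<dots>\<bar> = \<bar>real (g0 i) + 1 / 2 - real k * x i\<bar> / real k"
      using k by simp
    also have "\<dots> \<le> (1 / 2) / real k"
      using g0[OF i] by (intro divide_right_mono) (linarith, simp)
    finally show "\<bar>tree_point d k m g 0 i - x i\<bar> \<le> 1 / (2 * real k)" by simp
  qed simp
  then show ?thesis using mem by auto
qed

lemma small_committee_exists:
  assumes d: "d \<ge> 1" and p: "p \<ge> 1" and m: "m \<ge> 1" and eps: "0 < \<epsilon>" "\<epsilon> < 1 / 48"
  obtains E where "E \<in> committees d" "guarantees_regret d p m \<epsilon> E"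
    "real (length E) \<le> real m * ((145 / 48) * real d powr (1 / p) / \<epsilon>) ^ d"
proof -
  define D where "D = real d powr (1 / p)"
  have D: "D \<ge> 1" using d p by (simp add: D_def ge_one_powr_ge_zero)
  define k where "k = nat \<lceil>3 * D / \<epsilon>\<rceil>"
  have pos: "3 * D / \<epsilon> > 0" using D eps by simp
  then have k_ge: "real k \<ge> 3 * D / \<epsilon>" and "real k \<le> 3 * D / \<epsilon> + 1"
    unfolding k_def by linarith+
  \<comment> \<open>Rounding up costs at most one, which is at most
    \<open>D / (48 * \<epsilon>)\<close>; hence 3 + 1/48 = 145/48.\<close>
  moreover have "1 \<le> D / (48 * \<epsilon>)" using D eps by (simp add: field_simps)
  ultimately have k_le: "real k \<le> (145 / 48) * D / \<epsilon>" by (simp add: field_simps)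
  have k: "k \<ge> 1" using k_ge pos by linarith
  have kD: "3 * D \<le> real k * \<epsilon>" using k_ge eps by (simp add: field_simps)
  obtain E where E: "set E = tree_points d k m" "distinct E"
    using finite_distinct_list[OF card_tree_points(1)] by blast
  have com: "E \<in> committees d"
    using tree_points_subset_cube[OF m] E(1) by (auto simp: committees_def)
  \<comment> \<open>The \<open>m\<close> subdivisions of each edge cancel the factor
    \<open>m\<close> in the regret bound. Since \<open>D \<ge> 1\<close>, the remaining numerator
    \<open>D / 2 + 2\<close> is at most \<open>3 * D\<close>.\<close>
  have "D / (2 * real k) + 2 * (1 / (real m * real k)) * real m \<le> \<epsilon>"
  proof -
    have "D / (2 * real k) + 2 * (1 / (real m * real k)) * real m = (D / 2 + 2) / real k"
      using k m by (simp add: field_simps)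
    also have "\<dots> \<le> \<epsilon>" using kD D k by (simp add: field_simps)
    finally show ?thesis .
  qed
  then have "guarantees_regret d p m \<epsilon> E"
    using tree_points_cover[OF p m k] tree_points_connected[OF p m]
    by (intro guarantees_regret_of_chain_connected[OF p m com,
          where r = "D / (2 * real k)" and s = "1 / (real m * real k)"]) (auto simp: E(1) D_def)
  moreover have "length E = card (tree_points d k m)"
    using distinct_card[OF E(2)] E(1) by simp
  then have "real (length E) \<le> real (k ^ d * m)"
    using card_tree_points(2) by (metis of_nat_mono)
  then have "real (length E) \<le> real m * real k ^ d" by (simp add: mult.commute)
  moreover have "real m * real k ^ d \<le> real m * ((145 / 48) * D / \<epsilon>) ^ d"
    using k_le by (intro mult_left_mono power_mono) auto
  ultimately show ?thesis using that com by (auto simp: D_def)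
qed

subsection \<open>Volumes of \<open>\<ell>\<^sub>p\<close> balls\<close>

abbreviation lborel_pow :: "nat \<Rightarrow> (nat \<Rightarrow> real) measure"
  where "lborel_pow d \<equiv> Pi\<^sub>M {..<d} (\<lambda>_. lborel)"

text \<open>The ball is open and lives in the extensional functions that carry the product measure.
  The centre is read only on \<open>{..<d}\<close> and need not be extensional.\<close>

definition lp_ball :: "nat \<Rightarrow> real \<Rightarrow> (nat \<Rightarrow> real) \<Rightarrow> real \<Rightarrow> (nat \<Rightarrow> real) set"
  where "lp_ball d p a r = {x \<in> space (lborel_pow d). lp_dist d p x a < r}"

lemma lp_ball_sets [measurable]: "lp_ball d p a r \<in> sets (lborel_pow d)"
  unfolding lp_ball_def lp_dist_def by measurable

lemma cube_sets [measurable]: "cube d \<in> sets (lborel_pow d)"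
  unfolding cube_def by (rule sets_PiM_I_finite) auto

lemma product_sigma_finite_lborel: "product_sigma_finite (\<lambda>_. lborel :: real measure)"
  by (simp add: product_sigma_finite_def lborel.sigma_finite_measure_axioms)

lemma emeasure_cube: "emeasure (lborel_pow d) (cube d) = 1"
proof -
  interpret product_sigma_finite "\<lambda>_. lborel :: real measure"
    by (rule product_sigma_finite_lborel)
  show ?thesis unfolding cube_def by (subst emeasure_PiM) auto
qed

lemma nn_integral_exp_abs_le:
  fixes a \<mu> :: real
  assumes "\<mu> > 0"
  shows "(\<integral>\<^sup>+t. ennreal (exp (- (\<mu> * \<bar>t - a\<bar>))) \<partial>lborel) \<le> ennreal (2 / \<mu>)"
proof -
  have half: "(\<integral>\<^sup>+t. ennreal (exp (- (\<mu> * t))) * indicator {0..} t \<partial>lborel) = ennreal (1 / \<mu>)"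
  proof -
    have "LIM t at_top. \<mu> * t :> at_top"
      using assms by (intro filterlim_tendsto_pos_mult_at_top[OF tendsto_const] filterlim_ident)
    then have "((\<lambda>t. exp (- (\<mu> * t))) \<longlongrightarrow> 0) at_top"
      by (intro filterlim_compose[OF exp_at_bot]) (simp add: filterlim_uminus_at_top[symmetric])
    then have "((\<lambda>t. - exp (- (\<mu> * t)) / \<mu>) \<longlongrightarrow> 0) at_top"
      using tendsto_divide[OF tendsto_minus tendsto_const, of _ 0 at_top \<mu>] assms by fastforce
    then have "(\<integral>\<^sup>+t. ennreal (exp (- (\<mu> * t))) * indicator {0..} t \<partial>lborel)
        = ennreal (0 - (- exp (- (\<mu> * 0)) / \<mu>))"
      using assms by (intro nn_integral_FTC_atLeast) (auto intro!: derivative_eq_intros)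
    then show ?thesis by simp
  qed
  have "(\<integral>\<^sup>+t. ennreal (exp (- (\<mu> * \<bar>t - a\<bar>))) \<partial>lborel)
      = (\<integral>\<^sup>+t. ennreal (exp (- (\<mu> * \<bar>t\<bar>))) \<partial>lborel)"
    by (subst nn_integral_real_affine[where c = 1 and t = a]) auto
  \<comment> \<open>The line is split into two half-lines, each contributing
    \<open>1 / \<mu>\<close>; both contain \<open>0\<close>, hence only an inequality.\<close>
  also have "\<dots> \<le> (\<integral>\<^sup>+t. (ennreal (exp (- (\<mu> * t))) * indicator {0..} t
      + ennreal (exp (- (\<mu> * (- t)))) * indicator {0..} (- t)) \<partial>lborel)"
    by (intro nn_integral_mono) (auto simp: indicator_def abs_if)
  also have "\<dots> = (\<integral>\<^sup>+t. ennreal (exp (- (\<mu> * t))) * indicator {0..} t \<partial>lborel)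
      + (\<integral>\<^sup>+t. ennreal (exp (- (\<mu> * (- t)))) * indicator {0..} (- t) \<partial>lborel)"
    by (intro nn_integral_add) auto
  also have "(\<integral>\<^sup>+t. ennreal (exp (- (\<mu> * (- t)))) * indicator {0..} (- t) \<partial>lborel)
      = (\<integral>\<^sup>+t. ennreal (exp (- (\<mu> * t))) * indicator {0..} t \<partial>lborel)"
    by (subst (2) nn_integral_real_affine[where c = "-1" and t = 0]) auto
  finally show ?thesis
    unfolding half using assms by (simp flip: ennreal_plus)
qed

text \<open>
  A Chernoff bound: with \<open>\<mu> = d\<^bsup>1/p\<^esup> / r\<close>, every point of the ball satisfies
  \<open>\<Sum>i<d. \<mu> \<bar>x i - a i\<bar> \<le> 2 d\<close> because \<open>u \<le> u\<^sup>p + 1\<close>.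
\<close>

lemma emeasure_lp_ball_le:
  assumes d: "d \<ge> 1" and p: "p \<ge> 1" and r: "r > 0"
  shows "emeasure (lborel_pow d) (lp_ball d p a r)
           \<le> ennreal ((2 * exp 2 * r / real d powr (1 / p)) ^ d)"
proof -
  interpret product_sigma_finite "\<lambda>_. lborel :: real measure"
    by (rule product_sigma_finite_lborel)
  define \<mu> where "\<mu> = real d powr (1 / p) / r"
  have \<mu>: "\<mu> > 0" using d r by (simp add: \<mu>_def)
  \<comment> \<open>Exponentiating the linear bound gives a product, so the integral factors over
    the coordinates.\<close>
  have ind: "indicator (lp_ball d p a r) x \<le> (\<Prod>i<d. ennreal (exp 2 * exp (- (\<mu> * \<bar>x i - a i\<bar>))))"
    for x
  proof (cases "x \<in> lp_ball d p a r")
    case True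
    then have "lp_dist d p x a powr p \<le> r powr p"
      using p by (intro powr_mono2) (auto simp: lp_ball_def lp_dist_nonneg)
    then have sum_le: "(\<Sum>i<d. \<bar>x i - a i\<bar> powr p) \<le> r powr p"
      using p by (simp add: lp_dist_def powr_powr sum_nonneg)
    have le_powr: "u \<le> u powr p + 1" if "u \<ge> 0" for u :: real
    proof (cases "u \<ge> 1")
      case True
      then show ?thesis using powr_mono[of 1 p u] p by simp
    qed (use powr_ge_zero[of u p] in linarith)
    have "(\<Sum>i<d. \<mu> * \<bar>x i - a i\<bar>) \<le> (\<Sum>i<d. (\<mu> * \<bar>x i - a i\<bar>) powr p + 1)"
      using \<mu> by (intro sum_mono le_powr) auto
    also have "\<dots> = \<mu> powr p * (\<Sum>i<d. \<bar>x i - a i\<bar> powr p) + real d"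
      using \<mu> by (simp add: powr_mult sum.distrib sum_distrib_left)
    also have "\<dots> \<le> \<mu> powr p * r powr p + real d"
      using sum_le by (intro add_right_mono mult_left_mono) auto
    also have "\<mu> powr p * r powr p = real d"
      using r p d by (simp add: \<mu>_def powr_divide powr_powr)
    finally have "0 \<le> (\<Sum>i<d. 2 - \<mu> * \<bar>x i - a i\<bar>)"
      by (simp add: sum_subtractf)
    then have "1 \<le> exp (\<Sum>i<d. 2 - \<mu> * \<bar>x i - a i\<bar>)" by simp
    also have "\<dots> = (\<Prod>i<d. exp 2 * exp (- (\<mu> * \<bar>x i - a i\<bar>)))"
      by (simp add: exp_sum exp_diff exp_minus field_simps)
    finally show ?thesis using True by (subst prod_ennreal) auto
  qed auto
  have "emeasure (lborel_pow d) (lp_ball d p a r) = (\<integral>\<^sup>+x. indicator (lp_ball d p a r) x \<partial>lborel_pow d)"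
    by simp
  also have "\<dots> \<le> (\<integral>\<^sup>+x. (\<Prod>i<d. ennreal (exp 2 * exp (- (\<mu> * \<bar>x i - a i\<bar>)))) \<partial>lborel_pow d)"
    by (intro nn_integral_mono ind)
  also have "\<dots> = (\<Prod>i<d. \<integral>\<^sup>+t. ennreal (exp 2 * exp (- (\<mu> * \<bar>t - a i\<bar>))) \<partial>lborel)"
    by (rule product_nn_integral_prod) auto
  also have "\<dots> \<le> (\<Prod>i<d. ennreal (exp 2 * (2 / \<mu>)))"
  proof (intro prod_mono_ennreal)
    fix i
    have "(\<integral>\<^sup>+t. ennreal (exp 2 * exp (- (\<mu> * \<bar>t - a i\<bar>))) \<partial>lborel)
        = ennreal (exp 2) * (\<integral>\<^sup>+t. ennreal (exp (- (\<mu> * \<bar>t - a i\<bar>))) \<partial>lborel)"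
      by (subst nn_integral_cmult[symmetric]) (auto simp: ennreal_mult)
    also have "\<dots> \<le> ennreal (exp 2) * ennreal (2 / \<mu>)"
      using nn_integral_exp_abs_le[OF \<mu>] by (intro mult_left_mono) auto
    also have "\<dots> = ennreal (exp 2 * (2 / \<mu>))"
      using \<mu> by (intro ennreal_mult[symmetric]) auto
    finally show "(\<integral>\<^sup>+t. ennreal (exp 2 * exp (- (\<mu> * \<bar>t - a i\<bar>))) \<partial>lborel)
        \<le> ennreal (exp 2 * (2 / \<mu>))" .
  qed
  also have "\<dots> = ennreal ((exp 2 * (2 / \<mu>)) ^ d)"
    using \<mu> by (subst prod_ennreal) auto
  also have "exp 2 * (2 / \<mu>) = 2 * exp 2 * r / real d powr (1 / p)"
    by (simp add: \<mu>_def)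
  finally show ?thesis .
qed

text \<open>The affine map \<open>T\<close> pulls the ball back to the unit ball. That it scales
  volume by \<open>r ^ d\<close> need only be checked on boxes, coordinate by coordinate.\<close>

lemma emeasure_lp_ball_scale:
  assumes p: "p \<ge> 1" and r: "r > 0"
  shows "emeasure (lborel_pow d) (lp_ball d p a r)
           = ennreal (r ^ d) * emeasure (lborel_pow d) (lp_ball d p (\<lambda>_. 0) 1)"
proof -
  interpret product_sigma_finite "\<lambda>_. lborel :: real measure"
    by (rule product_sigma_finite_lborel)
  define T where "T = (\<lambda>x::nat \<Rightarrow> real. \<lambda>i\<in>{..<d}. a i + r * x i)"
  have T [measurable]: "T \<in> measurable (lborel_pow d) (lborel_pow d)"
    unfolding T_def by measurable
  have "scale_measure (ennreal (r ^ d)) (distr (lborel_pow d) (lborel_pow d) T) = lborel_pow d"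
  proof (rule PiM_eqI)
    fix A :: "nat \<Rightarrow> real set" assume A: "\<And>i. i \<in> {..<d} \<Longrightarrow> A i \<in> sets lborel"
    have pre: "T -` Pi\<^sub>E {..<d} A \<inter> space (lborel_pow d)
        = Pi\<^sub>E {..<d} (\<lambda>i. (\<lambda>t. a i + r * t) -` A i)"
      by (auto simp: T_def space_PiM PiE_iff)
    have meas: "(\<lambda>t. a i + r * t) -` A i \<in> sets lborel" if "i < d" for i
    proof -
      have "(\<lambda>t. a i + r * t) \<in> measurable borel borel" by measurable
      then show ?thesis using A[of i] that measurable_sets[of "\<lambda>t. a i + r * t" borel borel "A i"] by simp
    qed
    have one: "emeasure lborel (A i) = ennreal r * emeasure lborel ((\<lambda>t. a i + r * t) -` A i)"
      if "i < d" for i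
    proof -
      have "emeasure lborel (A i) = (\<integral>\<^sup>+t. indicator (A i) t \<partial>lborel)"
        using A that by simp
      also have "\<dots> = ennreal r * (\<integral>\<^sup>+t. indicator (A i) (a i + r * t) \<partial>lborel)"
        using A[of i] r that by (subst nn_integral_real_affine[where c = r and t = "a i"]) auto
      also have "(\<integral>\<^sup>+t. indicator (A i) (a i + r * t) \<partial>lborel)
          = (\<integral>\<^sup>+t. indicator ((\<lambda>t. a i + r * t) -` A i) t \<partial>lborel)"
        by (intro nn_integral_cong) (auto simp: indicator_def)
      finally show ?thesis using meas[OF that] by simp
    qed
    have "Pi\<^sub>E {..<d} A \<in> sets (lborel_pow d)" using A by (intro sets_PiM_I_finite) auto
    then have "emeasure (scale_measure (ennreal (r ^ d)) (distr (lborel_pow d) (lborel_pow d) T)) (Pi\<^sub>E {..<d} A)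
        = ennreal (r ^ d) * emeasure (lborel_pow d) (Pi\<^sub>E {..<d} (\<lambda>i. (\<lambda>t. a i + r * t) -` A i))"
      by (simp add: emeasure_distr pre)
    also have "\<dots> = ennreal (r ^ d) * (\<Prod>i<d. emeasure lborel ((\<lambda>t. a i + r * t) -` A i))"
      using meas by (subst emeasure_PiM) auto
    also have "\<dots> = (\<Prod>i<d. emeasure lborel (A i))"
      using r by (simp add: one prod.distrib ennreal_power)
    finally show "emeasure (scale_measure (ennreal (r ^ d)) (distr (lborel_pow d) (lborel_pow d) T)) (Pi\<^sub>E {..<d} A)
        = (\<Prod>i<d. emeasure lborel (A i))" .
  qed auto
  then have "emeasure (lborel_pow d) (lp_ball d p a r)
      = emeasure (scale_measure (ennreal (r ^ d)) (distr (lborel_pow d) (lborel_pow d) T)) (lp_ball d p a r)"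
    by simp
  also have "\<dots> = ennreal (r ^ d) * emeasure (lborel_pow d) (T -` lp_ball d p a r \<inter> space (lborel_pow d))"
    by (simp add: emeasure_distr)
  also have "T -` lp_ball d p a r \<inter> space (lborel_pow d) = lp_ball d p (\<lambda>_. 0) 1"
  proof -
    have "lp_dist d p (T x) a = r * lp_dist d p x (\<lambda>_. 0)" for x
      using r by (intro lp_dist_scale[OF p]) (auto simp: T_def abs_mult)
    then show ?thesis
      using r by (auto simp: lp_ball_def T_def space_PiM)
  qed
  finally show ?thesis .
qed

lemma emeasure_lp_unit_ball_pos:
  assumes d: "d \<ge> 1" and p: "p \<ge> 1"
  shows "emeasure (lborel_pow d) (lp_ball d p (\<lambda>_. 0) 1) > 0"
proof -
  interpret product_sigma_finite "\<lambda>_. lborel :: real measure"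
    by (rule product_sigma_finite_lborel)
  \<comment> \<open>With this half-width the points of the box have norm at most 1/2, so a box of
    positive volume fits inside.\<close>
  define h where "h = 1 / (2 * real d powr (1 / p))"
  have h: "h > 0" "h * real d powr (1 / p) < 1" using d by (auto simp: h_def)
  have "0 < ennreal ((2 * h) ^ d)" using h by simp
  also have "\<dots> = emeasure (lborel_pow d) (Pi\<^sub>E {..<d} (\<lambda>_. {-h..h}))"
    using h by (subst emeasure_PiM) (auto simp: ennreal_power)
  also have "\<dots> \<le> emeasure (lborel_pow d) (lp_ball d p (\<lambda>_. 0) 1)"
  proof (intro emeasure_mono)
    show "Pi\<^sub>E {..<d} (\<lambda>_. {-h..h}) \<subseteq> lp_ball d p (\<lambda>_. 0) 1"
    proof
      fix x assume x: "x \<in> Pi\<^sub>E {..<d} (\<lambda>_. {-h..h})"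
      then have "\<bar>x i - 0\<bar> \<le> h" if "i < d" for i
        using that PiE_mem[of x "{..<d}" "\<lambda>_. {-h..h}" i] by (auto simp: abs_le_iff)
      then have "lp_dist d p x (\<lambda>_. 0) \<le> h * real d powr (1 / p)"
        using h by (intro lp_dist_le_coordinatewise[OF p]) auto
      then show "x \<in> lp_ball d p (\<lambda>_. 0) 1"
        using x h by (auto simp: lp_ball_def space_PiM PiE_iff)
    qed
  qed auto
  finally show ?thesis .
qed

section \<open>Packing, nets and averaging\<close>

text \<open>Balls of radius \<open>\<delta> / 2\<close> around the points of \<open>T\<close> are
  disjoint and lie in one ball of radius \<open>R + \<delta> / 2\<close>; the unit ball volume,
  finite and positive, cancels.\<close>

lemma card_separated_le:
  assumes d: "d \<ge> 1" and p: "p \<ge> 1" and fin: "finite T" and \<delta>: "\<delta> > 0" and R: "R \<ge> 0"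
    and near: "\<And>z. z \<in> T \<Longrightarrow> lp_dist d p z a \<le> R"
    and sep: "\<And>y z. y \<in> T \<Longrightarrow> z \<in> T \<Longrightarrow> y \<noteq> z \<Longrightarrow> lp_dist d p y z \<ge> \<delta>"
  shows "real (card T) * (\<delta> / 2) ^ d \<le> (R + \<delta> / 2) ^ d"
proof -
  let ?V = "emeasure (lborel_pow d) (lp_ball d p (\<lambda>_. 0) 1)"
  have "?V < \<infinity>"
    using emeasure_lp_ball_le[OF d p, of 1 "\<lambda>_. 0"] by (auto simp: top_unique less_top[symmetric])
  then obtain V where V: "?V = ennreal V" "V \<ge> 0" by (cases ?V) auto
  then have "V > 0" using emeasure_lp_unit_ball_pos[OF d p] by simp
  have "disjoint_family_on (\<lambda>z. lp_ball d p z (\<delta> / 2)) T"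
  proof (unfold disjoint_family_on_def, intro ballI impI)
    fix y z assume yz: "y \<in> T" "z \<in> T" "y \<noteq> z"
    have "False" if "lp_dist d p x y < \<delta> / 2" "lp_dist d p x z < \<delta> / 2" for x
      using sep[OF yz] lp_dist_triangle[OF p, of d y z x] lp_dist_commute[of d p x y] that by simp
    then show "lp_ball d p y (\<delta> / 2) \<inter> lp_ball d p z (\<delta> / 2) = {}"
      by (auto simp: lp_ball_def)
  qed
  then have "(\<Sum>z\<in>T. emeasure (lborel_pow d) (lp_ball d p z (\<delta> / 2)))
      = emeasure (lborel_pow d) (\<Union>z\<in>T. lp_ball d p z (\<delta> / 2))"
    using fin by (intro sum_emeasure) auto
  also have "\<dots> \<le> emeasure (lborel_pow d) (lp_ball d p a (R + \<delta> / 2))"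
  proof (intro emeasure_mono subsetI)
    fix x assume "x \<in> (\<Union>z\<in>T. lp_ball d p z (\<delta> / 2))"
    then obtain z where z: "z \<in> T" "x \<in> lp_ball d p z (\<delta> / 2)" by blast
    then show "x \<in> lp_ball d p a (R + \<delta> / 2)"
      using near[OF z(1)] lp_dist_triangle[OF p, of d x a z] by (auto simp: lp_ball_def)
  qed auto
  finally have "of_nat (card T) * (ennreal ((\<delta> / 2) ^ d) * ennreal V) \<le> ennreal ((R + \<delta> / 2) ^ d) * ennreal V"
    using \<delta> R by (simp add: emeasure_lp_ball_scale[OF p] V)
  then have "ennreal (real (card T) * ((\<delta> / 2) ^ d * V)) \<le> ennreal ((R + \<delta> / 2) ^ d * V)"
    using \<delta> R V by (simp add: ennreal_mult ennreal_of_nat_eq_real_of_nat)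
  then have "real (card T) * (\<delta> / 2) ^ d * V \<le> (R + \<delta> / 2) ^ d * V"
    using \<delta> R V by (subst (asm) ennreal_le_iff) (auto simp: mult.assoc)
  then show ?thesis using \<open>V > 0\<close> by simp
qed

text \<open>A separated set of greatest cardinality is a net, since a point far from all of it could
  be added. The bound \<open>N\<close> makes the greatest cardinality exist.\<close>

lemma maximal_separated_subset:
  assumes bound: "\<And>T. finite T \<Longrightarrow> T \<subseteq> S \<Longrightarrow> (\<And>y z. y \<in> T \<Longrightarrow> z \<in> T \<Longrightarrow> y \<noteq> z \<Longrightarrow> lp_dist d p y z \<ge> \<delta>)
      \<Longrightarrow> card T \<le> N"
    and \<delta>: "\<delta> > 0"
  obtains T where "finite T" "T \<subseteq> S" "card T \<le> N" "\<And>y. y \<in> S \<Longrightarrow> \<exists>z\<in>T. lp_dist d p y z < \<delta>"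
proof -
  define sep where "sep T \<longleftrightarrow> finite T \<and> T \<subseteq> S
      \<and> (\<forall>y\<in>T. \<forall>z\<in>T. y \<noteq> z \<longrightarrow> lp_dist d p y z \<ge> \<delta>)" for T
  have le: "card T \<le> N" if "sep T" for T using that by (intro bound) (auto simp: sep_def)
  have "sep {}" by (simp add: sep_def)
  then obtain T where T: "sep T" and max: "\<And>U. sep U \<Longrightarrow> card U \<le> card T"
    using ex_has_greatest_nat[of sep "{}" card "Suc N"] le by (auto simp: less_Suc_eq_le)
  have "\<exists>z\<in>T. lp_dist d p y z < \<delta>" if y: "y \<in> S" for y
  proof (rule ccontr)
    assume no: "\<not> ?thesis"
    then have "y \<notin> T" using \<delta> by (auto simp: not_less dest: bspec[of _ _ y])
    moreover have "sep (insert y T)"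
      using T no y unfolding sep_def by (auto simp: not_less lp_dist_commute[of d p _ y])
    ultimately show False using max[of "insert y T"] T by (simp add: sep_def)
  qed
  then show ?thesis using that[of T] T le[OF T] by (auto simp: sep_def)
qed

text \<open>Double counting: the number of expert locations near \<open>x\<close>, integrated over
  the cube of volume one, is at least \<open>K\<close>, while each location contributes at most the
  volume of its ball.\<close>

lemma committee_size_ge:
  assumes d: "d \<ge> 1" and p: "p \<ge> 1" and R: "R > 0" and E: "E \<in> committees d"
    and many: "\<And>x. x \<in> cube d \<Longrightarrow> K \<le> card {e \<in> set E. lp_dist d p e x < R}"
  shows "real K \<le> real (length E) * (2 * exp 2 * R / real d powr (1 / p)) ^ d"
proof -
  let ?B = "(2 * exp 2 * R / real d powr (1 / p)) ^ d"
  have "of_nat K = of_nat K * emeasure (lborel_pow d) (cube d)"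
    by (simp add: emeasure_cube)
  also have "\<dots> = (\<integral>\<^sup>+x. of_nat K * indicator (cube d) x \<partial>lborel_pow d)"
    by (simp add: nn_integral_cmult)
  also have "\<dots> \<le> (\<integral>\<^sup>+x. (\<Sum>e\<in>set E. indicator (lp_ball d p e R) x) \<partial>lborel_pow d)"
  proof (intro nn_integral_mono)
    fix x assume x: "x \<in> space (lborel_pow d)"
    show "(of_nat K :: ennreal) * indicator (cube d) x \<le> (\<Sum>e\<in>set E. indicator (lp_ball d p e R) x)"
    proof (cases "x \<in> cube d")
      case True
      have "(\<Sum>e\<in>set E. indicator (lp_ball d p e R) x :: ennreal)
          = (\<Sum>e\<in>set E. if lp_dist d p e x < R then 1 else 0)"
        using x by (intro sum.cong) (auto simp: lp_ball_def lp_dist_commute[of d p x] indicator_def)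
      also have "\<dots> = of_nat (card {e \<in> set E. lp_dist d p e x < R})"
        by (simp add: sum.If_cases Int_def)
      finally show ?thesis using many[OF True] True by simp
    qed auto
  qed
  also have "\<dots> = (\<Sum>e\<in>set E. emeasure (lborel_pow d) (lp_ball d p e R))"
    by (subst nn_integral_sum) auto
  also have "\<dots> \<le> (\<Sum>e\<in>set E. ennreal ?B)"
    by (intro sum_mono emeasure_lp_ball_le d p R)
  also have "\<dots> = of_nat (card (set E)) * ennreal ?B" by simp
  also have "\<dots> \<le> of_nat (length E) * ennreal ?B"
    by (intro mult_right_mono) (auto simp: card_length)
  finally have "ennreal (real K) \<le> ennreal (real (length E) * ?B)"
    using R by (simp add: ennreal_mult ennreal_of_nat_eq_real_of_nat)
  then show ?thesis using R by (subst (asm) ennreal_le_iff) auto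
qed

subsection \<open>Lower bound\<close>

text \<open>Candidate locations may coincide, so a smaller set is padded to exactly \<open>m\<close>
  candidates by repeating one point.\<close>

lemma ex_enumeration:
  assumes "finite C" "C \<noteq> {}" "card C \<le> m"
  obtains c where "c \<in> {1..m} \<rightarrow>\<^sub>E C" "c ` {1..m} = C"
proof -
  obtain h where h: "bij_betw h {1..card C} C"
    using ex_bij_betw_nat_finite_1[OF assms(1)] by blast
  have "card C \<ge> 1" using assms by (simp add: Suc_leI card_gt_0_iff)
  define c where "c = (\<lambda>i\<in>{1..m}. if i \<le> card C then h i else h 1)"
  have mem: "h i \<in> C" if "1 \<le> i" "i \<le> card C" for i
    using h that by (auto simp: bij_betw_def)
  show ?thesis
  proof
    show "c \<in> {1..m} \<rightarrow>\<^sub>E C" using mem \<open>card C \<ge> 1\<close> by (auto simp: c_def)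
    show "c ` {1..m} = C"
    proof
      show "c ` {1..m} \<subseteq> C" using mem \<open>card C \<ge> 1\<close> by (auto simp: c_def)
      show "C \<subseteq> c ` {1..m}"
      proof
        fix x assume "x \<in> C"
        then obtain i where "i \<in> {1..card C}" "x = h i"
          using bij_betw_imp_surj_on[OF h] by blast
        then show "x \<in> c ` {1..m}"
          using assms(3) by (intro image_eqI[of _ _ i]) (auto simp: c_def)
      qed
    qed
  qed
qed

text \<open>
  Otherwise place a candidate on every expert of the ball, one at \<open>x\<^sub>0\<close>, and a \<open>3\<epsilon>\<close>-net on the
  sphere of radius \<open>6\<epsilon>\<close>. The 1-Lipschitz bump \<open>g\<close> of height \<open>3\<epsilon>\<close> at \<open>x\<^sub>0\<close> and its negative then
  produce the same votes: experts in the ball vote for the candidate at their own location, and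
  the net shields the experts outside from the bump. Regret at most \<open>\<epsilon>\<close> for \<open>g\<close> forces the selected
  candidate \<open>k\<close> to have \<open>g (c k) \<ge> 2\<epsilon>\<close>, for \<open>- g\<close> it forces \<open>g (c k) \<le> \<epsilon>\<close>.
\<close>

lemma many_experts_in_ball:
  assumes d: "d \<ge> 1" and p: "p \<ge> 1" and eps: "0 < \<epsilon>" "\<epsilon> < 1 / 48"
    and E: "E \<in> committees d" and guar: "guarantees_regret d p m \<epsilon> E" and x0: "x0 \<in> cube d"
  shows "m \<le> card {e \<in> set E. lp_dist d p e x0 < 6 * \<epsilon>} + 5 ^ d"
proof (rule ccontr)
  define K where "K = {e \<in> set E. lp_dist d p e x0 < 6 * \<epsilon>}"
  assume "\<not> ?thesis"
  then have m: "card K + 5 ^ d + 1 \<le> m" by (simp add: K_def)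
  note tri = lp_dist_triangle[OF p, of d] and comm = lp_dist_commute[of d p]
  have E_cube: "e \<in> cube d" if "e \<in> set E" for e
    using E that by (auto simp: committees_def)
  define S where "S = {y \<in> cube d. lp_dist d p y x0 = 6 * \<epsilon>}"
  obtain T where T: "finite T" "T \<subseteq> S" "card T \<le> 5 ^ d"
    and net: "\<And>y. y \<in> S \<Longrightarrow> \<exists>z\<in>T. lp_dist d p y z < 3 * \<epsilon>"
  proof (rule maximal_separated_subset[where S = S and d = d and p = p and \<delta> = "3 * \<epsilon>" and N = "5 ^ d"])
    fix U assume U: "finite U" "U \<subseteq> S"
      "\<And>y z. y \<in> U \<Longrightarrow> z \<in> U \<Longrightarrow> y \<noteq> z \<Longrightarrow> 3 * \<epsilon> \<le> lp_dist d p y z"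
    have "real (card U) * (3 * \<epsilon> / 2) ^ d \<le> (6 * \<epsilon> + 3 * \<epsilon> / 2) ^ d"
      using U eps by (intro card_separated_le[OF d p, where a = x0]) (auto simp: S_def)
    \<comment> \<open>The packing ratio of 7.5 to 1.5 is the source of the base 5.\<close>
    also have "6 * \<epsilon> + 3 * \<epsilon> / 2 = 5 * (3 * \<epsilon> / 2)" by simp
    also have "(5 * (3 * \<epsilon> / 2)) ^ d = 5 ^ d * (3 * \<epsilon> / 2) ^ d" by (rule power_mult_distrib)
    finally have "real (card U) \<le> 5 ^ d" using eps by simp
    then show "card U \<le> 5 ^ d"
      by (metis of_nat_le_iff of_nat_numeral of_nat_power)
  qed (use eps in auto)
  \<comment> \<open>Moving one coordinate by \<open>6 * \<epsilon>\<close>, less than 1/2, away from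
    the nearer face stays in the cube. It yields a candidate \<open>z0\<close> where the bump
    vanishes, needed to bound the maximum of the negative bump from below.\<close>
  have "S \<noteq> {}"
  proof -
    have x00: "0 \<le> x0 0" "x0 0 \<le> 1" using x0 d by (auto simp: cube_def PiE_iff)
    define y where "y = x0(0 := if x0 0 \<le> 1 / 2 then x0 0 + 6 * \<epsilon> else x0 0 - 6 * \<epsilon>)"
    have "0 \<le> y 0 \<and> y 0 \<le> 1" using x00 eps by (simp add: y_def)
    moreover have "y i = x0 i" if "i \<noteq> 0" for i using that by (simp add: y_def)
    ultimately have "0 \<le> y i \<and> y i \<le> 1" if "i < d" for i
      using x0 that by (cases "i = 0") (auto simp: cube_def PiE_iff)
    moreover have "y \<in> extensional {..<d}"
      using x0 d by (auto simp: cube_def PiE_iff extensional_def y_def)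
    ultimately have "y \<in> cube d" by (auto simp: cube_def PiE_iff)
    moreover have "lp_dist d p y x0 = \<bar>y 0 - x0 0\<bar>"
      using d by (intro lp_dist_single_coordinate[OF p]) (auto simp: y_def)
    then have "lp_dist d p y x0 = 6 * \<epsilon>" using eps by (simp add: y_def)
    ultimately show ?thesis by (auto simp: S_def)
  qed
  then obtain z0 where z0: "z0 \<in> T" using net by blast

  define C where "C = insert x0 (T \<union> K)"
  have "card C \<le> Suc (card T + card K)"
    using T(1) card_Un_le[of T K] by (auto simp: C_def K_def card_insert_if)
  then have "card C \<le> m" using T(3) m by linarith
  moreover have "finite C" "C \<noteq> {}" using T(1) by (auto simp: C_def K_def)
  ultimately obtain c where c: "c \<in> {1..m} \<rightarrow>\<^sub>E C" "c ` {1..m} = C"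
    using ex_enumeration by blast
  have "C \<subseteq> cube d" using T(2) x0 E_cube by (auto simp: C_def K_def S_def)
  then have c_loc: "c \<in> candidate_locations d m"
    using c(1) by (auto simp: candidate_locations_def PiE_iff)

  define g where "g x = max 0 (3 * \<epsilon> - lp_dist d p x x0)" for x
  have g_lip: "\<bar>g x - g y\<bar> \<le> lp_dist d p x y" for x y
    using tri[of x x0 y] tri[of y x0 x] comm[of x y] lp_dist_nonneg[of d p x y] by (auto simp: g_def)
  \<comment> \<open>The favourite is chosen before the sign \<open>\<sigma>\<close>, so both quality
    vectors admit the same vote profile.\<close>
  have "\<exists>x\<in>C. \<forall>y\<in>C. \<forall>\<sigma>\<in>{1, -1}. \<sigma> * g y - lp_dist d p e y \<le> \<sigma> * g x - lp_dist d p e x"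
    if e: "e \<in> set E" for e
  proof (cases "e \<in> K")
    case True
    then show ?thesis
      using g_lip[of e] by (intro bexI[of _ e]) (auto simp: C_def abs_le_iff algebra_simps)
  next
    case False
    then have far: "6 * \<epsilon> \<le> lp_dist d p e x0" using e by (auto simp: K_def)
    \<comment> \<open>The nearest candidate with bump zero is the vote of an outside expert; its
      quality is the same for both signs.\<close>
    define Z where "Z = {z \<in> C. g z = 0}"
    have TZ: "T \<subseteq> Z" using T(2) eps by (auto simp: Z_def C_def S_def g_def)
    have "finite Z" "Z \<noteq> {}" using \<open>finite C\<close> z0 TZ by (auto simp: Z_def)
    then obtain z where z: "z \<in> Z" "\<And>y. y \<in> Z \<Longrightarrow> lp_dist d p e z \<le> lp_dist d p e y"
      using arg_min_if_finite[of Z "lp_dist d p e"] by (metis not_less)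
    \<comment> \<open>The segment from \<open>x0\<close> to \<open>e\<close> crosses the sphere at
      \<open>s\<close>, at distance \<open>6 * \<epsilon>\<close> from \<open>x0\<close>, and a net
      point lies within \<open>3 * \<epsilon>\<close> of \<open>s\<close>.\<close>
    have z_near: "lp_dist d p e z \<le> lp_dist d p e x0 - 3 * \<epsilon>"
    proof -
      define \<tau> where "\<tau> = 6 * \<epsilon> / lp_dist d p e x0"
      have \<tau>: "0 \<le> \<tau>" "\<tau> \<le> 1" "\<tau> * lp_dist d p e x0 = 6 * \<epsilon>"
        using far eps by (auto simp: \<tau>_def)
      define s where "s = (\<lambda>i\<in>{..<d}. (1 - \<tau>) * x0 i + \<tau> * e i)"
      have "s i \<in> {0..1}" if "i < d" for i
      proof -
        have "0 \<le> x0 i" "x0 i \<le> 1" "0 \<le> e i" "e i \<le> 1"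
          using x0 E_cube[OF e] that by (auto simp: cube_def PiE_iff)
        then show ?thesis
          using \<tau> that convex_bound_le[of "x0 i" 1 "e i" "1 - \<tau>" \<tau>] by (auto simp: s_def)
      qed
      then have "s \<in> cube d" by (auto simp: cube_def s_def)
      moreover have "lp_dist d p s x0 = \<tau> * lp_dist d p e x0"
      proof (rule lp_dist_scale[OF p])
        fix i assume "i < d"
        then have "s i - x0 i = \<tau> * (e i - x0 i)" by (simp add: s_def algebra_simps)
        then show "\<bar>s i - x0 i\<bar> = \<tau> * \<bar>e i - x0 i\<bar>" using \<tau> by (simp add: abs_mult)
      qed (rule \<tau>)
      ultimately have "s \<in> S" using \<tau> by (simp add: S_def)
      then obtain z' where z': "z' \<in> T" "lp_dist d p s z' < 3 * \<epsilon>" using net by blast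
      have "lp_dist d p e s = (1 - \<tau>) * lp_dist d p e x0"
      proof (rule lp_dist_scale[OF p])
        fix i assume "i < d"
        then have "e i - s i = (1 - \<tau>) * (e i - x0 i)" by (simp add: s_def algebra_simps)
        then show "\<bar>e i - s i\<bar> = (1 - \<tau>) * \<bar>e i - x0 i\<bar>" using \<tau> by (simp add: abs_mult)
      qed (use \<tau> in simp)
      then have "lp_dist d p e s = lp_dist d p e x0 - 6 * \<epsilon>"
        using \<tau>(3) by (simp add: left_diff_distrib)
      then have "lp_dist d p e z' \<le> lp_dist d p e x0 - 3 * \<epsilon>"
        using tri[of e z' s] z'(2) by linarith
      then show ?thesis using z(2)[of z'] z'(1) TZ by force
    qed
    show ?thesis
    proof (intro bexI[of _ z] ballI)
      fix y \<sigma>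
      assume y: "y \<in> C" and \<sigma>: "\<sigma> \<in> {1, -1::real}"
      have "\<sigma> * g y - lp_dist d p e y \<le> - lp_dist d p e z"
      proof (cases "g y = 0")
        case True
        then show ?thesis using z(2)[of y] y by (simp add: Z_def)
      next
        case False
        then have "g y = 3 * \<epsilon> - lp_dist d p y x0" and "g y > 0"
          by (auto simp: g_def max_def split: if_splits)
        moreover have "\<sigma> * g y \<le> g y" using \<sigma> \<open>g y > 0\<close> by auto
        \<comment> \<open>Under the bump the height lost equals the distance to \<open>x0\<close>,
          so no candidate there offers more than
          \<open>3 * \<epsilon> - lp_dist d p e x0\<close>.\<close>
        ultimately show ?thesis using tri[of e x0 y] z_near by linarith
      qed
      then show "\<sigma> * g y - lp_dist d p e y \<le> \<sigma> * g z - lp_dist d p e z"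
        using z(1) by (simp add: Z_def)
    qed (use z(1) in \<open>simp add: Z_def\<close>)
  qed
  then have "\<exists>k\<in>{1..m}. \<forall>j\<in>{1..m}. \<forall>\<sigma>\<in>{1, -1}.
      \<sigma> * g (c j) - lp_dist d p e (c j) \<le> \<sigma> * g (c k) - lp_dist d p e (c k)" if "e \<in> set E" for e
    using that unfolding c(2)[symmetric] by blast
  then obtain V where V: "\<And>e. e \<in> set E \<Longrightarrow> V e \<in> {1..m}"
    "\<And>e j \<sigma>. e \<in> set E \<Longrightarrow> j \<in> {1..m} \<Longrightarrow> \<sigma> \<in> {1, -1} \<Longrightarrow>
      \<sigma> * g (c j) - lp_dist d p e (c j) \<le> \<sigma> * g (c (V e)) - lp_dist d p e (c (V e))"
    by metis
  have arise: "votes_arise d p m c (\<lambda>j. \<sigma> * g (c j)) E (map V E)" if "\<sigma> \<in> {1, -1}" for \<sigma>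
    using V that by (force simp: votes_arise_def is_arg_max_def not_less)

  obtain f where f: "voting_rule d m f"
    and regret: "\<And>q v. votes_arise d p m c q E v \<Longrightarrow> Max (q ` {1..m}) - q (f c E v) \<le> \<epsilon>"
    using guar c_loc unfolding guarantees_regret_def by blast
  define k where "k = f c E (map V E)"
  have le_Max: "\<sigma> * g y \<le> Max ((\<lambda>j. \<sigma> * g (c j)) ` {1..m})" if "y \<in> C" for y \<sigma>
    using that unfolding c(2)[symmetric] by (intro Max_ge) auto
  have "3 * \<epsilon> = 1 * g x0" using eps by (simp add: g_def)
  also have "\<dots> \<le> g (c k) + \<epsilon>"
    using regret[OF arise, of 1] le_Max[of x0 1] by (simp add: C_def k_def)
  finally have "2 * \<epsilon> \<le> g (c k)" by simp
  moreover have "- 1 * g z0 \<le> - g (c k) + \<epsilon>"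
    using regret[OF arise, of "-1"] le_Max[of z0 "-1"] z0 by (simp add: C_def k_def)
  moreover have "g z0 = 0" using z0 T(2) eps by (auto simp: S_def g_def)
  ultimately show False using eps by simp
qed

subsection \<open>Size of a minimum committee\<close>

text \<open>The square root lies between 1 and \<open>2 ^ d\<close>: the upper bound can give it
  away, and the lower bound can absorb it into the base of the exponential.\<close>

lemma dimension_factor:
  assumes "d \<ge> 1" "p \<ge> 1"
  shows "(real d powr (1 / p)) ^ d = real d powr (real d / p)"
    and "1 \<le> sqrt (real d / p + 1)" and "sqrt (real d / p + 1) \<le> 2 ^ d"
proof -
  show "(real d powr (1 / p)) ^ d = real d powr (real d / p)"
    using assms by (simp add: powr_powr flip: powr_realpow)
  show "1 \<le> sqrt (real d / p + 1)" using assms by simp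
  have "real d / p \<le> real d" using assms by (simp add: divide_le_eq mult_left_le)
  moreover have "real d + 1 \<le> 2 ^ d"
    using assms less_exp[of d] by (metis Suc_eq_plus1 Suc_leI of_nat_1 of_nat_add of_nat_le_iff of_nat_numeral of_nat_power)
  moreover have "(2::real) ^ d \<le> (2 ^ d)\<^sup>2"
    by (simp add: power2_eq_square)
  ultimately show "sqrt (real d / p + 1) \<le> 2 ^ d"
    by (intro real_le_lsqrt) auto
qed

lemma sqrt_two_pi_le: "(145 / 48) * sqrt (2 * pi) \<le> 3 * exp 1"
proof -
  have "sqrt (2 * pi) \<le> sqrt (2.51\<^sup>2)"
    using pi_approx by (intro real_sqrt_le_mono) (simp add: power2_eq_square)
  then have "sqrt (2 * pi) \<le> 2.51" by simp
  moreover have "exp 1 = exp (1 / 2 :: real) * exp (1 / 2)" by (simp flip: exp_add)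
  \<comment> \<open>The quadratic Taylor bound at 1 gives only 2.5 for \<open>exp 1\<close>, which
    is too weak; squaring the bound at 1/2 gives about 2.64.\<close>
  moreover have "(1.625 :: real) \<le> exp (1 / 2)"
    using exp_lower_Taylor_quadratic[of "1 / 2"] by (simp add: power2_eq_square)
  then have "(1.625 :: real) * 1.625 \<le> exp (1 / 2) * exp (1 / 2)"
    by (intro mult_mono) auto
  ultimately show ?thesis by simp
qed

lemma minimum_committee_length_le:
  assumes d: "d \<ge> 1" and p: "p \<ge> 1" and eps: "0 < \<epsilon>" "\<epsilon> < 1 / 48" and m: "m \<ge> 1"
    and E: "minimum_committee d p m \<epsilon> E"
  shows "real (length E) \<le> real m * (3 * exp 1 / (\<epsilon> * sqrt (2 * pi))) ^ d
           * real d powr (real d / p) * sqrt (real d / p + 1)"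
proof -
  define D where "D = real d powr (1 / p)"
  define L where "L = sqrt (real d / p + 1)"
  have D: "D > 0" "D ^ d = real d powr (real d / p)"
    using d dimension_factor(1)[OF d p] by (auto simp: D_def)
  have L: "1 \<le> L" using dimension_factor(2)[OF d p] by (simp add: L_def)
  obtain E' where E': "E' \<in> committees d" "guarantees_regret d p m \<epsilon> E'"
    "real (length E') \<le> real m * ((145 / 48) * D / \<epsilon>) ^ d"
    using small_committee_exists[OF d p m eps] unfolding D_def by blast
  have "145 / 48 \<le> 3 * exp 1 / sqrt (2 * pi)"
    using sqrt_two_pi_le by (simp add: pos_le_divide_eq)
  then have "(145 / 48) * (D / \<epsilon>) \<le> 3 * exp 1 / sqrt (2 * pi) * (D / \<epsilon>)"
    using D(1) eps by (intro mult_right_mono) auto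
  then have "(145 / 48) * D / \<epsilon> \<le> 3 * exp 1 / (\<epsilon> * sqrt (2 * pi)) * D"
    by (simp add: mult.commute)
  then have "((145 / 48) * D / \<epsilon>) ^ d \<le> (3 * exp 1 / (\<epsilon> * sqrt (2 * pi)) * D) ^ d"
    using D(1) eps by (intro power_mono) auto
  also have "\<dots> = (3 * exp 1 / (\<epsilon> * sqrt (2 * pi))) ^ d * real d powr (real d / p)"
    by (simp only: power_mult_distrib D(2))
  also have "\<dots> \<le> (3 * exp 1 / (\<epsilon> * sqrt (2 * pi))) ^ d * real d powr (real d / p) * L"
    using mult_left_mono[OF L, of "(3 * exp 1 / (\<epsilon> * sqrt (2 * pi))) ^ d * real d powr (real d / p)"] eps
    by simp
  finally have "real m * ((145 / 48) * D / \<epsilon>) ^ d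
      \<le> real m * ((3 * exp 1 / (\<epsilon> * sqrt (2 * pi))) ^ d * real d powr (real d / p) * L)"
    by (intro mult_left_mono) auto
  moreover have "length E \<le> length E'"
    using E E'(1,2) by (auto simp: minimum_committee_def is_arg_min_def not_less)
  ultimately show ?thesis using E'(3) by (simp add: L_def mult.assoc)
qed

lemma minimum_committee_length_ge:
  assumes d: "d \<ge> 1" and p: "p \<ge> 1" and eps: "0 < \<epsilon>" "\<epsilon> < 1 / 48" and m: "m \<ge> 12 ^ d + 1"
    and E: "minimum_committee d p m \<epsilon> E"
  shows "real m / 2 * ((1 / (1152 * exp (1 / 12) * \<epsilon> * sqrt pi)) ^ d
           * real d powr (real d / p) * sqrt (real d / p + 1)) \<le> real (length E)"
proof -
  define D where "D = real d powr (1 / p)"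
  define L where "L = sqrt (real d / p + 1)"
  have D: "D > 0" "D ^ d = real d powr (real d / p)"
    using d dimension_factor(1)[OF d p] by (auto simp: D_def)
  have L: "1 \<le> L" "L \<le> 2 ^ d" using dimension_factor[OF d p] by (auto simp: L_def)
  have com: "E \<in> committees d" and guar: "guarantees_regret d p m \<epsilon> E"
    using E by (auto simp: minimum_committee_def is_arg_min_def)
  define B where "B = 2 * exp 2 * (6 * \<epsilon>) / D"
  have B: "B > 0" using D eps by (simp add: B_def)
  have "real (m - 5 ^ d) \<le> real (length E) * B ^ d"
    unfolding B_def D_def
    using many_experts_in_ball[OF d p eps com guar] eps
    by (intro committee_size_ge[OF d p _ com]) (auto simp: le_diff_conv)
  \<comment> \<open>Twice \<open>5 ^ d\<close> is at most \<open>10 ^ d\<close>, hence below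
    \<open>m\<close>; discarding the net costs at most half of \<open>m\<close>.\<close>
  moreover have "real m / 2 \<le> real (m - 5 ^ d)"
  proof -
    have "2 * 5 ^ d \<le> (2::nat) ^ d * 5 ^ d" using d by (simp add: self_le_power)
    also have "\<dots> = 10 ^ d" by (simp flip: power_mult_distrib)
    also have "\<dots> \<le> 12 ^ d" by (intro power_mono) auto
    finally show ?thesis using m by linarith
  qed
  ultimately have size: "real m / 2 \<le> real (length E) * B ^ d" by linarith
  \<comment> \<open>The left side is \<open>24 * exp 2 * \<epsilon>\<close>, at most
    \<open>216 * \<epsilon>\<close>. The factor 2 is reserved to absorb the square root as
    \<open>2 ^ d\<close>.\<close>
  have "2 * B * D \<le> 1152 * exp (1 / 12) * \<epsilon> * sqrt pi"
  proof -
    have "exp 2 = exp 1 * exp (1 :: real)" by (simp flip: exp_add)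
    then have "exp 2 \<le> (3 * 3 :: real)"
      using exp_le by (metis exp_ge_zero mult_mono order_trans)
    moreover have "1 * 1 \<le> exp (1 / 12) * sqrt pi"
      using pi_ge_two by (intro mult_mono) auto
    ultimately have "24 * exp 2 \<le> 1152 * (exp (1 / 12) * sqrt pi)" by linarith
    then have "24 * exp 2 * \<epsilon> \<le> 1152 * (exp (1 / 12) * sqrt pi) * \<epsilon>"
      using eps by (intro mult_right_mono) auto
    then show ?thesis using D(1) by (simp add: B_def mult_ac)
  qed
  then have "1 / (1152 * exp (1 / 12) * \<epsilon> * sqrt pi) \<le> 1 / (2 * B * D)"
    using B D(1) eps by (intro divide_left_mono) auto
  then have "(1 / (1152 * exp (1 / 12) * \<epsilon> * sqrt pi)) ^ d \<le> (1 / (2 * B * D)) ^ d"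
    using eps by (intro power_mono) auto
  then have "(1 / (1152 * exp (1 / 12) * \<epsilon> * sqrt pi)) ^ d * D ^ d * L \<le> (1 / (2 * B * D)) ^ d * D ^ d * 2 ^ d"
    using L D(1) B eps by (intro mult_mono mult_nonneg_nonneg) auto
  also have "\<dots> = 1 / B ^ d"
    using B D(1) by (simp add: power_divide power_mult_distrib)
  finally have "real m / 2 * ((1 / (1152 * exp (1 / 12) * \<epsilon> * sqrt pi)) ^ d * D ^ d * L)
      \<le> real m / 2 * (1 / B ^ d)"
    by (intro mult_left_mono) auto
  also have "\<dots> \<le> real (length E)"
    using size B by (simp add: divide_le_eq)
  finally show ?thesis by (simp add: D(2) L_def)
qed

theorem theoremA3:
  "\<exists>a > (0::real). \<exists>b > (0::real).
     \<forall>(d::nat) (p::real) (\<epsilon>::real) (m::nat) (E :: (nat \<Rightarrow> real) list).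
       d \<ge> 1 \<and> p \<ge> 1 \<and> 0 < \<epsilon> \<and> \<epsilon> < 1 / 48 \<and> m \<ge> 12 ^ d + 1 \<and> minimum_committee d p m \<epsilon> E \<longrightarrow>
         a * (real m * (1 / (1152 * exp (1 / 12) * \<epsilon> * sqrt pi)) ^ d
               * real d powr (real d / p) * sqrt (real d / p + 1)) \<le> real (length E) \<and>
         real (length E) \<le>
           b * (real m * (3 * exp 1 / (\<epsilon> * sqrt (2 * pi))) ^ d
               * real d powr (real d / p) * sqrt (real d / p + 1))"
proof (rule exI[of _ "1 / 2"], rule conjI, simp, rule exI[of _ 1], rule conjI, simp,
    intro allI impI, elim conjE, rule conjI)
  fix d m :: nat and p \<epsilon> :: real and E :: "(nat \<Rightarrow> real) list"
  assume hyps: "d \<ge> 1" "p \<ge> 1" "0 < \<epsilon>" "\<epsilon> < 1 / 48" "m \<ge> 12 ^ d + 1" "minimum_committee d p m \<epsilon> E"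
  show "1 / 2 * (real m * (1 / (1152 * exp (1 / 12) * \<epsilon> * sqrt pi)) ^ d
          * real d powr (real d / p) * sqrt (real d / p + 1)) \<le> real (length E)"
    using minimum_committee_length_ge[OF hyps] by (simp add: mult.assoc)
  show "real (length E) \<le> 1 * (real m * (3 * exp 1 / (\<epsilon> * sqrt (2 * pi))) ^ d
          * real d powr (real d / p) * sqrt (real d / p + 1))"
    using minimum_committee_length_le[OF hyps(1-4) _ hyps(6)] hyps(5) by simp
qed

end
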